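(* Let $\mathbb{X},\mathbb{Y}$ be finite-dimensional real inner product spaces, $\mathbb{Z}=\mathbb{X}\times\mathbb{Y}$, $B:\mathbb{X}\to\mathbb{Y}$ linear, $g:\mathbb{X}\to(-\infty,+\infty]$ and $h:\mathbb{Y}\to(-\infty,+\infty]$ closed proper convex, and $f:\mathbb{X}\to\mathbb{R}$ differentiable convex with $\|\nabla f(x)-\nabla f(x')\|\le L\|x-x'\|$ for all $x,x'$. Let $T:\mathbb{Z}\rightrightarrows\mathbb{Z}$, $T(x,y)=\big(\partial g(x)+\nabla f(x)+B^*y,\ \partial h^*(y)-Bx\big)$. Let $\{(\overline{x}^k,\overline{y}^k,x^k,y^k)\}$ be generated by the AFBAS-PD algorithm with parameters $\gamma_1,\gamma_2,\theta,\mu,\lambda_k$ and step sizes $\alpha_k$ as described in the context. Put $w^k=(\overline{x}^k,\overline{y}^k)$, $z^k=(x^k,y^k)$, $v^k=R(z^k-w^k)$, $\epsilon_k=L\|x^k-\overline{x}^k\|^2/4$, $\theta_k=\alpha_k-1$ and $\mathcal{M}=RS^{-1}$, with $$R=\begin{pmatrix}\gamma_1^{-1}\mathcal{I}&-B^*\\(1-\theta)B&\gamma_2^{-1}\mathcal{I}\end{pmatrix},\qquad S=\begin{pmatrix}\mathcal{I}&-\mu\gamma_1(2-\theta)B^*\\\gamma_2(1-\mu)(2-\theta)B&\mathcal{I}\end{pmatrix}.$$ Then there is $\sigma\in[0,1)$ such that for all $k$ $$v^k\in T^{[\epsilon_k]}(w^k),$$ $$\theta_k\|\mathcal{M}^{-1}v^k\|_{\mathcal{M}}^2+\|\mathcal{M}^{-1}v^k+w^k-z^k\|_{\mathcal{M}}^2+2\epsilon_k\le\sigma\|w^k-z^k\|_{\mathcal{M}}^2,$$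 $$z^{k+1}=z^k-(1+\theta_k)\mathcal{M}^{-1}v^k.$$
   Context: AFBAS-PD algorithm. Parameters $\gamma_1,\gamma_2>0$, $\mu\in[0,1]$, $\theta\in[0,\infty)$ with $\gamma_1^{-1}-\gamma_2\theta^2\|B\|^2/4>L/4$; iterations $$\overline{x}^k=\mathrm{Prox}_{\gamma_1g}\big(x^k-\gamma_1B^*y^k-\gamma_1\nabla f(x^k)\big),\quad\overline{y}^k=\mathrm{Prox}_{\gamma_2h^*}\big(y^k+\gamma_2B((1-\theta)x^k+\theta\overline{x}^k)\big),$$ $$x^{k+1}=x^k+\alpha_k\big((\overline{x}^k-x^k)-\mu\gamma_1(2-\theta)B^*(\overline{y}^k-y^k)\big),$$ $$y^{k+1}=y^k+\alpha_k\big(\gamma_2(1-\mu)(2-\theta)B(\overline{x}^k-x^k)+(\overline{y}^k-y^k)\big).$$ The step size (for iterates with $(\overline{x}^k,\overline{y}^k)\ne(x^k,y^k)$) is $$\alpha_k=\frac{\lambda_k\big(\gamma_1^{-1}\|\overline{x}^k-x^k\|^2+\gamma_2^{-1}\|\overline{y}^k-y^k\|^2-\theta\langle\overline{x}^k-x^k,B^*(\overline{y}^k-y^k)\rangle\big)}{V(\overline{x}^k-x^k,\overline{y}^k-y^k)},$$ with $\lambda_k\in[\underline{\lambda},\overline{\lambda}]\subseteq(0,\delta)$, $\delta=2-\frac{L}{2}(\gamma_1^{-1}-\gamma_2\theta^2\|B\|^2/4)^{-1}$, and $$V(x,y)=\gamma_1^{-1}\|x\|^2+\gamma_2^{-1}\|y\|^2+(1-\mu)\gamma_2(1-\theta)(2-\theta)\|Bx\|^2+\mu\gamma_1(2-\theta)\|B^*y\|^2+2\big((1-\mu)(1-\theta)-\mu\big)\langle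 x,B^*y\rangle.$$ Under these parameter conditions $\mathcal{M}=RS^{-1}$ is self-adjoint positive definite. Notation. $h^*$ is the convex conjugate; $\mathrm{Prox}_{cg}(u)=\arg\min_xg(x)+\frac1{2c}\|x-u\|^2$; $\|z\|_{\mathcal{M}}=\sqrt{\langle z,\mathcal{M}z\rangle}$. For $\epsilon\ge0$, $T^{[\epsilon]}(z)=\{v\in\mathbb{Z}\mid\langle u-v,z'-z\rangle\ge-\epsilon\ \forall z'\in\mathbb{Z},\ \forall u\in T(z')\}$. *)

theory Defs
  imports "HOL-Analysis.Analysis"
begin

definition epi :: "('a \<Rightarrow> ereal) \<Rightarrow> ('a \<times> real) set" where
  "epi f = {(x, r). f x \<le> ereal r}"

definition closed_proper_convex :: "('a::euclidean_space \<Rightarrow> ereal) \<Rightarrow> bool" where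
  "closed_proper_convex f \<longleftrightarrow>
     (\<forall>x. f x \<noteq> -\<infinity>) \<and> (\<exists>x. f x \<noteq> \<infinity>) \<and> convex (epi f) \<and> closed (epi f)"

definition convex_conjugate :: "('a::euclidean_space \<Rightarrow> ereal) \<Rightarrow> 'a \<Rightarrow> ereal" where
  "convex_conjugate h u = (SUP x. ereal (u \<bullet> x) - h x)"

(* For proper g the subdifferential is empty outside the domain of g: at a point where
   g is infinite the inequality would force g to be infinite everywhere. *)
definition subdifferential :: "('a::euclidean_space \<Rightarrow> ereal) \<Rightarrow> 'a \<Rightarrow> 'a set" where
  "subdifferential g x = {u. \<forall>x'. g x + ereal (u \<bullet> (x' - x)) \<le> g x'}"

(* The minimizer exists and is unique when g is closed proper convex and c > 0;
   for other arguments the value is unspecified. *)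
definition prox :: "real \<Rightarrow> ('a::euclidean_space \<Rightarrow> ereal) \<Rightarrow> 'a \<Rightarrow> 'a" where
  "prox c g u = (ARG_MIN (\<lambda>x. g x + ereal (1 / (2 * c) * (norm (x - u))\<^sup>2)) x. True)"

definition enlargement :: "real \<Rightarrow> ('a::real_inner \<Rightarrow> 'a set) \<Rightarrow> 'a \<Rightarrow> 'a set" where
  "enlargement \<epsilon> T z = {v. \<forall>z'. \<forall>u \<in> T z'. (u - v) \<bullet> (z' - z) \<ge> - \<epsilon>}"

definition norm_wrt :: "('a::real_inner \<Rightarrow> 'a) \<Rightarrow> 'a \<Rightarrow> real" where
  "norm_wrt M z = sqrt (z \<bullet> M z)"

definition pd_operator ::
  "('a::euclidean_space \<Rightarrow> ereal) \<Rightarrow> ('b::euclidean_space \<Rightarrow> ereal) \<Rightarrow> ('a \<Rightarrow> 'a) \<Rightarrow> ('a \<Rightarrow> 'b)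
     \<Rightarrow> 'a \<times> 'b \<Rightarrow> ('a \<times> 'b) set" where
  "pd_operator g h gradf B = (\<lambda>(x, y).
     {(p + gradf x + adjoint B y, q - B x) | p q.
        p \<in> subdifferential g x \<and> q \<in> subdifferential (convex_conjugate h) y})"

definition pd_R ::
  "real \<Rightarrow> real \<Rightarrow> real \<Rightarrow> ('a::euclidean_space \<Rightarrow> 'b::euclidean_space) \<Rightarrow> 'a \<times> 'b \<Rightarrow> 'a \<times> 'b" where
  "pd_R \<gamma>1 \<gamma>2 \<theta> B = (\<lambda>(x, y).
     (inverse \<gamma>1 *\<^sub>R x - adjoint B y,
      (1 - \<theta>) *\<^sub>R B x + inverse \<gamma>2 *\<^sub>R y))"

definition pd_S ::
  "real \<Rightarrow> real \<Rightarrow> real \<Rightarrow> real \<Rightarrow> ('a::euclidean_space \<Rightarrow> 'b::euclidean_space)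
     \<Rightarrow> 'a \<times> 'b \<Rightarrow> 'a \<times> 'b" where
  "pd_S \<gamma>1 \<gamma>2 \<theta> \<mu> B = (\<lambda>(x, y).
     (x - (\<mu> * \<gamma>1 * (2 - \<theta>)) *\<^sub>R adjoint B y,
      (\<gamma>2 * (1 - \<mu>) * (2 - \<theta>)) *\<^sub>R B x + y))"

definition pd_V ::
  "real \<Rightarrow> real \<Rightarrow> real \<Rightarrow> real \<Rightarrow> ('a::euclidean_space \<Rightarrow> 'b::euclidean_space)
     \<Rightarrow> 'a \<Rightarrow> 'b \<Rightarrow> real" where
  "pd_V \<gamma>1 \<gamma>2 \<theta> \<mu> B x y =
     inverse \<gamma>1 * (norm x)\<^sup>2 + inverse \<gamma>2 * (norm y)\<^sup>2
     + (1 - \<mu>) * \<gamma>2 * (1 - \<theta>) * (2 - \<theta>) * (norm (B x))\<^sup>2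
     + \<mu> * \<gamma>1 * (2 - \<theta>) * (norm (adjoint B y))\<^sup>2
     + 2 * ((1 - \<mu>) * (1 - \<theta>) - \<mu>) * (x \<bullet> adjoint B y)"

end

theory Submission
  imports Defs begin

text \<open>
  One iteration is a relaxed step of a hybrid proximal extragradient method in the metric
  \<open>M = R S\<inverse>\<close>. Write \<open>d = z - w\<close>, so that \<open>v = R d\<close> and therefore \<open>M\<inverse> v = S d\<close>;
  the update of \<open>z\<close> is then literally \<open>z - \<alpha> S d\<close>.

  \<^emph>\<open>Membership.\<close> The optimality conditions of the two proximal steps give \<open>p \<in> \<partial>g(xbar)\<close> and
  \<open>q \<in> \<partial>h*(ybar)\<close> with \<open>v = (p + \<nabla>f(x) + B* ybar, q - B xbar)\<close>. This would be an element of
  \<open>T(w)\<close> if the gradient were taken at \<open>xbar\<close> instead of \<open>x\<close>. In the inequality that defines the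
  enlargement, \<open>p\<close> and \<open>q\<close> contribute nonnegative terms by monotonicity, the skew part cancels,
  and evaluating the gradient at the wrong point costs at most \<open>L \<parallel>x - xbar\<parallel>\<^sup>2 / 4\<close>
  (\<open>gradient_almost_monotone\<close>). The optimality conditions presuppose that the proximal points
  exist, for \<open>g\<close> and for the conjugate of \<open>h\<close>; both facts rest on an affine minorant obtained by
  separating a point from the closed convex epigraph.

  \<^emph>\<open>Error criterion.\<close> Since \<open>M\<close> is self-adjoint and \<open>M S = R\<close>, expanding the squares gives
  \<open>(\<alpha> - 1) \<parallel>S d\<parallel>\<^sub>M\<^sup>2 + \<parallel>S d - d\<parallel>\<^sub>M\<^sup>2 = \<alpha> \<langle>S d, R d\<rangle> - 2 \<langle>d, R d\<rangle> + \<parallel>d\<parallel>\<^sub>M\<^sup>2\<close>.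
  Here \<open>\<langle>S d, R d\<rangle> = V(d)\<close>, and the step size is chosen to make \<open>\<alpha> V(d) = \<lambda> \<langle>d, R d\<rangle>\<close>
  (\<open>relaxed_step_identity\<close>). It remains to bound \<open>(2 - \<lambda>) \<langle>d, R d\<rangle> - L \<parallel>x - xbar\<parallel>\<^sup>2 / 2\<close> from below by
  a fixed fraction of \<open>\<parallel>d\<parallel>\<^sub>M\<^sup>2\<close>. With \<open>\<kappa> = 1/\<gamma>1 - \<gamma>2 \<theta>\<^sup>2 \<parallel>B\<parallel>\<^sup>2 / 4\<close>, completing the square gives
  \<open>\<langle>d, R d\<rangle> \<ge> \<kappa> \<parallel>x - xbar\<parallel>\<^sup>2\<close>, and \<open>\<delta> = 2 - L / (2 \<kappa>)\<close>; so what is left after paying the error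
  term is at least \<open>(\<delta> - \<lambda>) \<langle>d, R d\<rangle>\<close>, with \<open>\<delta> - \<lambda>\<close> bounded away from \<open>0\<close>. Coercivity of \<open>R\<close>
  and boundedness of \<open>M\<close> turn this into a multiple of \<open>\<parallel>d\<parallel>\<^sub>M\<^sup>2\<close> that does not depend on \<open>k\<close>.
\<close>

section \<open>Conjugates, proximal points and subgradients\<close>

lemma norm_add_scaleR_square:
  "(norm (e + t *\<^sub>R d))\<^sup>2 = (norm e)\<^sup>2 + 2 * t * (e \<bullet> d) + t\<^sup>2 * (norm d)\<^sup>2"
  unfolding power2_norm_eq_inner
  by (simp add: inner_add_left inner_add_right inner_commute[of d e] power2_eq_square distrib_left)

text \<open>
  A point strictly below the graph is separated from the epigraph. The hyperplane cannot be
  vertical, because the point on the graph straight above it lies on the other side.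
\<close>
lemma affine_minorant:
  assumes "closed_proper_convex g"
  obtains p \<beta> where "\<And>x r. (x, r) \<in> epi g \<Longrightarrow> p \<bullet> x + \<beta> \<le> r"
proof -
  obtain x0 where "g x0 \<noteq> \<infinity>" "g x0 \<noteq> -\<infinity>"
    using assms by (auto simp: closed_proper_convex_def)
  then obtain r0 where r0: "g x0 = ereal r0" by (cases "g x0") auto
  have below: "(x0, r0 - 1) \<notin> epi g" and on: "(x0, r0) \<in> epi g"
    by (auto simp: epi_def r0)
  have "convex (epi g)" "closed (epi g)"
    using assms by (auto simp: closed_proper_convex_def)
  then obtain a b where ab: "a \<bullet> (x0, r0 - 1) < b" "\<forall>z\<in>epi g. b < a \<bullet> z"
    using separating_hyperplane_closed_point below by blast
  obtain q s where a: "a = (q, s)" by fastforce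
  have "q \<bullet> x0 + s * (r0 - 1) < b" "b < q \<bullet> x0 + s * r0"
    using ab on by (auto simp: a)
  then have s: "s > 0" by (simp add: algebra_simps)
  have "(- (1 / s) *\<^sub>R q) \<bullet> x + b / s \<le> r" if "(x, r) \<in> epi g" for x r
  proof -
    have "b < q \<bullet> x + s * r" using ab(2) that by (force simp: a)
    then show ?thesis using s by (simp add: field_simps)
  qed
  then show ?thesis by (rule that)
qed

text \<open>
  Intersecting half-spaces over the epigraph of \<open>h\<close> instead of over its domain absorbs the
  infinite values of \<open>h\<close>.
\<close>
lemma epi_convex_conjugate:
  "epi (convex_conjugate h) = (\<Inter>(x, s)\<in>epi h. {(u, r). u \<bullet> x - s \<le> r})"
proof -
  have "convex_conjugate h u \<le> ereal r \<longleftrightarrow> (\<forall>x s. h x \<le> ereal s \<longrightarrow> u \<bullet> x - s \<le> r)" for u r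
  proof -
    have "ereal (u \<bullet> x) - h x \<le> ereal r \<longleftrightarrow> (\<forall>s. h x \<le> ereal s \<longrightarrow> u \<bullet> x - s \<le> r)" for x
    proof (cases "h x")
      case (real t)
      then show ?thesis by (auto simp: algebra_simps intro: order_trans)
    next
      case MInf
      have "\<not> u \<bullet> x - (u \<bullet> x - r - 1) \<le> r" by simp
      with MInf show ?thesis by (auto intro: exI[of _ "u \<bullet> x - r - 1"])
    qed auto
    then show ?thesis by (auto simp: convex_conjugate_def SUP_le_iff)
  qed
  then show ?thesis by (auto simp: epi_def)
qed

lemma closed_proper_convex_conjugate:
  assumes "closed_proper_convex h"
  shows "closed_proper_convex (convex_conjugate h)"
proof -
  have half: "{(u, r). u \<bullet> x - s \<le> r} = {z. (x, -1) \<bullet> z \<le> s}" for x :: 'a and s :: real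
    by (auto simp: inner_commute)
  have "convex (epi (convex_conjugate h))" "closed (epi (convex_conjugate h))"
    unfolding epi_convex_conjugate half
    by (auto intro!: convex_INT closed_INT simp: convex_halfspace_le closed_halfspace_le)
  moreover obtain x0 where "h x0 \<noteq> \<infinity>" "h x0 \<noteq> -\<infinity>"
    using assms by (auto simp: closed_proper_convex_def)
  then obtain r0 where r0: "h x0 = ereal r0" by (cases "h x0") auto
  have "ereal (u \<bullet> x0 - r0) \<le> convex_conjugate h u" for u
    unfolding convex_conjugate_def by (rule SUP_upper2[of x0]) (auto simp: r0)
  then have "convex_conjugate h u \<noteq> -\<infinity>" for u by (metis ereal_infty_less_eq(2) PInfty_neq_ereal(1) MInfty_neq_ereal(2))
  \<comment> \<open>An affine minorant of slope \<open>p\<close> is the same thing as a finite upper bound for the conjugate at \<open>p\<close>.\<close>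
  moreover obtain p \<beta> where "\<And>x r. (x, r) \<in> epi h \<Longrightarrow> p \<bullet> x + \<beta> \<le> r"
    using affine_minorant[OF assms] by blast
  then have "(p, -\<beta>) \<in> epi (convex_conjugate h)"
    unfolding epi_convex_conjugate by force
  then have "convex_conjugate h p \<noteq> \<infinity>" by (auto simp: epi_def)
  ultimately show ?thesis unfolding closed_proper_convex_def by blast
qed

text \<open>
  Minimizing over the epigraph replaces lower semicontinuity by closedness: the objective becomes a
  continuous function of \<open>(x, r)\<close>. Its sublevel sets are bounded since the quadratic term
  outgrows the affine minorant.
\<close>
lemma epi_quadratic_attains_min:
  assumes g: "closed_proper_convex g" and c: "c > 0"
  obtains a r where "(a, r) \<in> epi g"
    "\<And>x s. (x, s) \<in> epi g \<Longrightarrow> r + 1 / (2 * c) * (norm (a - u))\<^sup>2 \<le> s + 1 / (2 * c) * (norm (x - u))\<^sup>2"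
proof -
  define \<Phi> :: "'a \<times> real \<Rightarrow> real" where "\<Phi> z = snd z + 1 / (2 * c) * (norm (fst z - u))\<^sup>2" for z
  obtain p \<beta> where min: "\<And>x r. (x, r) \<in> epi g \<Longrightarrow> p \<bullet> x + \<beta> \<le> r"
    using affine_minorant[OF g] by blast
  obtain x0 where "g x0 \<noteq> \<infinity>" "g x0 \<noteq> -\<infinity>"
    using g by (auto simp: closed_proper_convex_def)
  then obtain r0 where r0: "(x0, r0) \<in> epi g" by (cases "g x0") (auto simp: epi_def)
  define m where "m = \<Phi> (x0, r0)"
  define K where "K = epi g \<inter> {z. \<Phi> z \<le> m}"
  \<comment> \<open>\<open>e\<close> minimizes the sum of the affine minorant and the quadratic term; \<open>\<rho>\<close> bounds the distance
    from \<open>e\<close> at which that sum is still at most \<open>m\<close>.\<close>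
  define e where "e = u - c *\<^sub>R p"
  define \<rho> where "\<rho> = sqrt (2 * c * (m - \<beta> - p \<bullet> u + c / 2 * (norm p)\<^sup>2))"
  have cont: "continuous_on A \<Phi>" for A unfolding \<Phi>_def by (intro continuous_intros)
  have "K \<subseteq> cball e \<rho> \<times> {p \<bullet> e + \<beta> - norm p * \<rho>..m}"
  proof safe
    fix x r assume "(x, r) \<in> K"
    then have lo: "p \<bullet> x + \<beta> \<le> r" and hi: "r + 1 / (2 * c) * (norm (x - u))\<^sup>2 \<le> m"
      by (auto simp: K_def \<Phi>_def intro: min)
    have "x - e = (x - u) + c *\<^sub>R p" by (simp add: e_def)
    then have "(norm (x - e))\<^sup>2 = (norm (x - u))\<^sup>2 + 2 * c * ((x - u) \<bullet> p) + c\<^sup>2 * (norm p)\<^sup>2"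
      by (simp only: norm_add_scaleR_square)
    moreover have "1 / (2 * c) * (norm (x - u))\<^sup>2 \<le> m - p \<bullet> x - \<beta>"
      using lo hi by linarith
    then have "(norm (x - u))\<^sup>2 \<le> 2 * c * (m - p \<bullet> x - \<beta>)"
      using c by (simp add: pos_divide_le_eq mult.commute)
    ultimately have "(norm (x - e))\<^sup>2 \<le> 2 * c * (m - \<beta> - p \<bullet> u + c / 2 * (norm p)\<^sup>2)"
      by (simp add: inner_diff_left inner_commute[of _ p] algebra_simps power2_eq_square)
    then have n: "norm (x - e) \<le> \<rho>" unfolding \<rho>_def using real_le_rsqrt by blast
    then show "x \<in> cball e \<rho>" by (simp add: dist_norm norm_minus_commute)
    have "\<bar>p \<bullet> (x - e)\<bar> \<le> norm p * \<rho>"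
      using Cauchy_Schwarz_ineq2 n by (meson mult_left_mono norm_ge_zero order_trans)
    moreover have "0 \<le> 1 / (2 * c) * (norm (x - u))\<^sup>2" using c by simp
    then have "r \<le> m" using hi by linarith
    ultimately show "r \<in> {p \<bullet> e + \<beta> - norm p * \<rho>..m}"
      using lo by (auto simp: inner_diff_right)
  qed
  then have "bounded K" 
    by (rule bounded_subset[rotated]) (intro bounded_Times bounded_cball bounded_closed_interval)
  moreover have "closed K" unfolding K_def
    using g by (intro closed_Int closed_Collect_le cont continuous_intros) (auto simp: closed_proper_convex_def)
  ultimately have "compact K" by (simp add: compact_eq_bounded_closed)
  moreover have "(x0, r0) \<in> K" using r0 by (simp add: K_def m_def)
  ultimately obtain z where z: "z \<in> K" "\<And>z'. z' \<in> K \<Longrightarrow> \<Phi> z \<le> \<Phi> z'"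
    using continuous_attains_inf[OF _ _ cont] by (metis empty_iff)
  have "\<Phi> z \<le> \<Phi> z'" if "z' \<in> epi g" for z'
    using z that by (cases "\<Phi> z' \<le> m") (auto simp: K_def)
  then show ?thesis using that[of "fst z" "snd z"] z(1) by (fastforce simp: K_def \<Phi>_def)
qed

lemma prox_epi_minimal:
  assumes g: "closed_proper_convex g" and c: "c > 0"
  obtains r where "g (prox c g u) = ereal r"
    "\<And>x s. (x, s) \<in> epi g \<Longrightarrow>
       r + 1 / (2 * c) * (norm (prox c g u - u))\<^sup>2 \<le> s + 1 / (2 * c) * (norm (x - u))\<^sup>2"
proof -
  define \<phi> where "\<phi> x = g x + ereal (1 / (2 * c) * (norm (x - u))\<^sup>2)" for x
  have ninf: "g x \<noteq> -\<infinity>" for x using g by (simp add: closed_proper_convex_def)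
  obtain a r where a: "(a, r) \<in> epi g"
    and min: "\<And>x s. (x, s) \<in> epi g \<Longrightarrow> r + 1 / (2 * c) * (norm (a - u))\<^sup>2 \<le> s + 1 / (2 * c) * (norm (x - u))\<^sup>2"
    using epi_quadratic_attains_min[OF g c] by metis
  have \<phi>a: "\<phi> a \<le> ereal (r + 1 / (2 * c) * (norm (a - u))\<^sup>2)"
    using a by (cases "g a") (auto simp: \<phi>_def epi_def)
  moreover have "ereal (r + 1 / (2 * c) * (norm (a - u))\<^sup>2) \<le> \<phi> x" for x
    using ninf[of x] min[of x] by (cases "g x") (auto simp: \<phi>_def epi_def)
  ultimately have "is_arg_min \<phi> (\<lambda>_. True) a"
    unfolding is_arg_min_def by (meson leD order_trans)
  then have "is_arg_min \<phi> (\<lambda>_. True) (prox c g u)"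
    unfolding prox_def arg_min_def \<phi>_def by (rule someI)
  then have le: "\<phi> (prox c g u) \<le> \<phi> x" for x
    by (auto simp: is_arg_min_def not_less)
  have "\<phi> (prox c g u) \<noteq> \<infinity>" using le[of a] \<phi>a by auto
  then obtain t where t: "g (prox c g u) = ereal t"
    using ninf by (cases "g (prox c g u)") (auto simp: \<phi>_def)
  have "t + 1 / (2 * c) * (norm (prox c g u - u))\<^sup>2 \<le> s + 1 / (2 * c) * (norm (x - u))\<^sup>2"
    if "(x, s) \<in> epi g" for x s
  proof -
    have "\<phi> x \<le> ereal (s + 1 / (2 * c) * (norm (x - u))\<^sup>2)"
      using that by (cases "g x") (auto simp: \<phi>_def epi_def)
    with le[of x] have "\<phi> (prox c g u) \<le> ereal (s + 1 / (2 * c) * (norm (x - u))\<^sup>2)" by (rule order_trans)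
    then show ?thesis by (simp add: \<phi>_def t)
  qed
  with t show ?thesis by (rule that)
qed

text \<open>
  Fermat's rule: comparing the proximal point \<open>a\<close> with \<open>a + t (x - a)\<close> and dividing by \<open>t\<close> leaves
  the subgradient inequality up to a term of order \<open>t\<close>, which vanishes in the limit.
\<close>
lemma prox_subgradient:
  assumes g: "closed_proper_convex g" and c: "c > 0"
  shows "inverse c *\<^sub>R (u - prox c g u) \<in> subdifferential g (prox c g u)"
proof -
  define a where "a = prox c g u"
  obtain r where ga: "g a = ereal r"
    and min: "\<And>x s. (x, s) \<in> epi g \<Longrightarrow>
       r + 1 / (2 * c) * (norm (a - u))\<^sup>2 \<le> s + 1 / (2 * c) * (norm (x - u))\<^sup>2"
    unfolding a_def using prox_epi_minimal[OF g c] by metis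
  have "r + inverse c *\<^sub>R (u - a) \<bullet> (x - a) \<le> s" if s: "g x = ereal s" for x s
  proof -
    have cvx: "convex (epi g)" using g by (simp add: closed_proper_convex_def)
    have "r - s + inverse c *\<^sub>R (u - a) \<bullet> (x - a) \<le> t * ((norm (x - a))\<^sup>2 / (2 * c))"
      if t: "0 < t" "t < 1" for t
    proof -
      have "(1 - t) *\<^sub>R (a, r) + t *\<^sub>R (x, s) \<in> epi g"
        using t ga s by (intro convexD_alt[OF cvx]) (auto simp: epi_def)
      then have "(a + t *\<^sub>R (x - a), r + t * (s - r)) \<in> epi g"
        by (simp add: algebra_simps)
      from min[OF this] have "t * (r - s) \<le> 1 / (2 * c) * ((norm (a - u + t *\<^sub>R (x - a)))\<^sup>2 - (norm (a - u))\<^sup>2)"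
        by (simp add: algebra_simps)
      also have "\<dots> = t * (inverse c *\<^sub>R (a - u) \<bullet> (x - a) + t * ((norm (x - a))\<^sup>2 / (2 * c)))"
        using c unfolding norm_add_scaleR_square
        by (simp add: divide_simps) (simp add: power2_eq_square algebra_simps)
      finally have "r - s \<le> inverse c *\<^sub>R (a - u) \<bullet> (x - a) + t * ((norm (x - a))\<^sup>2 / (2 * c))"
        using t(1) by (simp only: mult_le_cancel_left_pos)
      then show ?thesis by (simp add: inner_diff_left algebra_simps)
    qed
    then have "\<forall>\<^sub>F t in at_right 0. r - s + inverse c *\<^sub>R (u - a) \<bullet> (x - a) \<le> t * ((norm (x - a))\<^sup>2 / (2 * c))"
      by (auto simp: eventually_at_right_field intro!: exI[of _ 1])
    moreover have "((\<lambda>t. t * ((norm (x - a))\<^sup>2 / (2 * c))) \<longlongrightarrow> 0 * ((norm (x - a))\<^sup>2 / (2 * c))) (at_right 0)"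
      by (intro tendsto_intros)
    ultimately have "r - s + inverse c *\<^sub>R (u - a) \<bullet> (x - a) \<le> 0 * ((norm (x - a))\<^sup>2 / (2 * c))"
      by (intro tendsto_lowerbound) (auto simp: trivial_limit_at_right_real)
    then show ?thesis by simp
  qed
  moreover have "g x \<noteq> -\<infinity>" for x using g by (simp add: closed_proper_convex_def)
  ultimately have "ereal r + ereal (inverse c *\<^sub>R (u - a) \<bullet> (x - a)) \<le> g x" for x
    by (cases "g x") auto
  then show ?thesis unfolding subdifferential_def by (simp add: ga flip: a_def)
qed

lemma subdifferential_monotone:
  assumes "closed_proper_convex g" "p \<in> subdifferential g x" "p' \<in> subdifferential g x'"
  shows "(p' - p) \<bullet> (x' - x) \<ge> 0"
proof -
  have sub: "g x + ereal (p \<bullet> (w - x)) \<le> g w" "g x' + ereal (p' \<bullet> (w - x')) \<le> g w" for w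
    using assms by (auto simp: subdifferential_def)
  obtain x0 where x0: "g x0 \<noteq> \<infinity>" and n: "\<And>w. g w \<noteq> -\<infinity>"
    using assms(1) by (auto simp: closed_proper_convex_def)
  obtain r where "g x = ereal r" using sub(1)[of x0] x0 n[of x] by (cases "g x") auto
  moreover obtain r' where "g x' = ereal r'" using sub(2)[of x0] x0 n[of x'] by (cases "g x'") auto
  ultimately have "r + p \<bullet> (x' - x) \<le> r'" "r' + p' \<bullet> (x - x') \<le> r"
    using sub(1)[of x'] sub(2)[of x] by auto
  then show ?thesis by (simp add: inner_simps)
qed

section \<open>Smooth convex functions\<close>

lemma GDERIV_along_line:
  assumes "\<And>u. GDERIV f u :> gradf u"
  shows "((\<lambda>t. f (a + t *\<^sub>R d)) has_real_derivative (gradf (a + t *\<^sub>R d) \<bullet> d)) (at t within A)"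
proof -
  have line: "((\<lambda>t. a + t *\<^sub>R d) has_derivative (\<lambda>h. h *\<^sub>R d)) (at t within A)"
    by (auto intro!: derivative_eq_intros)
  have "(f has_derivative (\<lambda>h. h \<bullet> gradf (a + t *\<^sub>R d))) (at (a + t *\<^sub>R d))"
    using assms by (simp add: gderiv_def)
  from has_derivative_compose[OF line this]
  show ?thesis
    unfolding has_field_derivative_def
    by (rule has_derivative_eq_rhs) (simp add: fun_eq_iff inner_commute mult.commute)
qed

lemma convex_above_tangent:
  fixes f :: "'a::euclidean_space \<Rightarrow> real"
  assumes "convex_on UNIV f" and "\<And>u. GDERIV f u :> gradf u"
  shows "f a + gradf a \<bullet> (u - a) \<le> f u"
proof -
  have "convex_on UNIV (\<lambda>t. f (a + t *\<^sub>R (u - a)))"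
  proof (rule convex_onI)
    fix t x y :: real assume t: "0 < t" "t < 1"
    have "a + ((1 - t) *\<^sub>R x + t *\<^sub>R y) *\<^sub>R (u - a) =
        (1 - t) *\<^sub>R (a + x *\<^sub>R (u - a)) + t *\<^sub>R (a + y *\<^sub>R (u - a))"
      by (simp add: algebra_simps)
    then show "f (a + ((1 - t) *\<^sub>R x + t *\<^sub>R y) *\<^sub>R (u - a)) \<le>
        (1 - t) * f (a + x *\<^sub>R (u - a)) + t * f (a + y *\<^sub>R (u - a))"
      using convex_onD[OF assms(1)] t by simp
  qed auto
  moreover have "((\<lambda>t. f (a + t *\<^sub>R (u - a))) has_real_derivative gradf a \<bullet> (u - a)) (at 0)"
    using GDERIV_along_line[of f gradf a "u - a" 0 UNIV] assms(2) by simp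
  ultimately have "gradf a \<bullet> (u - a) * (1 - 0) \<le> f (a + 1 *\<^sub>R (u - a)) - f (a + 0 *\<^sub>R (u - a))"
    by (intro convex_on_imp_above_tangent[where A = UNIV]) auto
  then show ?thesis by simp
qed

text \<open>
  Along the segment from \<open>a\<close> to \<open>u\<close>, the Lipschitz bound makes the difference of the two sides a
  function with nonpositive derivative.
\<close>
lemma descent_lemma:
  fixes f :: "'a::euclidean_space \<Rightarrow> real"
  assumes "\<And>u. GDERIV f u :> gradf u"
    and lip: "\<And>u u'. norm (gradf u - gradf u') \<le> L * norm (u - u')"
  shows "f u \<le> f a + gradf a \<bullet> (u - a) + L / 2 * (norm (u - a))\<^sup>2"
proof -
  define d where "d = u - a"
  define \<psi> where "\<psi> t = f (a + t *\<^sub>R d) - t * (gradf a \<bullet> d) - L / 2 * t\<^sup>2 * (norm d)\<^sup>2" for t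
  note line = GDERIV_along_line[of f gradf, OF assms(1), of a d]
  have deriv: "\<exists>y. DERIV \<psi> t :> y \<and> y \<le> 0" if t: "0 \<le> t" "t \<le> 1" for t
  proof (intro exI conjI)
    show "DERIV \<psi> t :> gradf (a + t *\<^sub>R d) \<bullet> d - gradf a \<bullet> d - L * t * (norm d)\<^sup>2"
      unfolding \<psi>_def by (rule line derivative_eq_intros refl | simp)+
    have "(gradf (a + t *\<^sub>R d) - gradf a) \<bullet> d \<le> norm (gradf (a + t *\<^sub>R d) - gradf a) * norm d"
      by (rule norm_cauchy_schwarz)
    also have "\<dots> \<le> L * norm (t *\<^sub>R d) * norm d"
      using lip[of "a + t *\<^sub>R d" a] by (intro mult_right_mono) auto
    also have "\<dots> = L * t * (norm d)\<^sup>2" using t by (simp add: power2_eq_square)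
    finally show "gradf (a + t *\<^sub>R d) \<bullet> d - gradf a \<bullet> d - L * t * (norm d)\<^sup>2 \<le> 0"
      by (simp add: inner_diff_left)
  qed
  have "\<psi> 1 \<le> \<psi> 0" by (rule DERIV_nonpos_imp_nonincreasing[OF zero_le_one deriv])
  then show ?thesis by (simp add: \<psi>_def d_def)
qed

text \<open>
  This is what cocoercivity of the gradient yields after Young's inequality. It also follows directly
  by sandwiching \<open>f\<close> between a tangent at one of \<open>a\<close>, \<open>b\<close> and the descent parabola at the other,
  at two test points whose difference is \<open>a - c\<close>; splitting \<open>c - b\<close> evenly between them
  produces the factor \<open>1/4\<close>, and no division by \<open>L\<close> occurs.
\<close>
lemma gradient_almost_monotone:
  fixes f :: "'a::euclidean_space \<Rightarrow> real"
  assumes "convex_on UNIV f" and "\<And>u. GDERIV f u :> gradf u"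
    and "\<And>u u'. norm (gradf u - gradf u') \<le> L * norm (u - u')"
  shows "(gradf a - gradf b) \<bullet> (a - c) \<ge> - (L * (norm (b - c))\<^sup>2 / 4)"
proof -
  define s where "s = (1 / 2) *\<^sub>R (c - b)"
  have "f b + gradf b \<bullet> (a - s - b) \<le> f a + gradf a \<bullet> (- s) + L / 2 * (norm (- s))\<^sup>2"
    using convex_above_tangent[OF assms(1,2), of b "a - s"] descent_lemma[OF assms(2,3), of "a - s" a]
    by simp
  moreover have "f a + gradf a \<bullet> (b + s - a) \<le> f b + gradf b \<bullet> s + L / 2 * (norm s)\<^sup>2"
    using convex_above_tangent[OF assms(1,2), of a "b + s"] descent_lemma[OF assms(2,3), of "b + s" b]
    by simp
  moreover have "(norm s)\<^sup>2 = (norm (b - c))\<^sup>2 / 4"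
    by (simp add: s_def norm_minus_commute power2_eq_square)
  moreover have "c = b + (s + s)" by (simp add: s_def flip: scaleR_left_distrib)
  then have "gradf a \<bullet> c = gradf a \<bullet> b + 2 * (gradf a \<bullet> s)" "gradf b \<bullet> c = gradf b \<bullet> b + 2 * (gradf b \<bullet> s)"
    by (simp_all add: inner_add_right)
  ultimately show ?thesis by (simp add: inner_simps algebra_simps)
qed


section \<open>The metric of the primal-dual step\<close>

lemma complete_square_lower_bound:
  fixes \<gamma> :: real
  assumes "\<gamma> > 0"
  shows "- (\<gamma> * s\<^sup>2 * (norm v)\<^sup>2) \<le> inverse \<gamma> * (norm y)\<^sup>2 + 2 * s * (v \<bullet> y)"
proof -
  have "0 \<le> inverse \<gamma> * (norm (y + (\<gamma> * s) *\<^sub>R v))\<^sup>2" using assms by simp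
  also have "\<dots> = inverse \<gamma> * (norm y)\<^sup>2 + 2 * s * (v \<bullet> y) + \<gamma> * s\<^sup>2 * (norm v)\<^sup>2"
    using assms unfolding norm_add_scaleR_square
    by (simp add: inner_commute[of v y] power_mult_distrib field_simps) (simp add: power2_eq_square)
  finally show ?thesis by simp
qed

text \<open>
  The assumption \<open>gap\<close> is what makes the quadratic form of \<open>R\<close> coercive and \<open>V\<close> positive: the mixed
  term \<open>\<theta> \<langle>x, B* y\<rangle>\<close> is dominated by the two squares.
\<close>
locale pd_parameters =
  fixes B :: "'a::euclidean_space \<Rightarrow> 'b::euclidean_space"
    and \<gamma>1 \<gamma>2 \<theta> \<mu> :: real
  assumes linear_B: "linear B"
    and \<gamma>1: "\<gamma>1 > 0" and \<gamma>2: "\<gamma>2 > 0" and \<mu>: "0 \<le> \<mu>" "\<mu> \<le> 1"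
    and gap: "\<gamma>2 * \<theta>\<^sup>2 * (onorm B)\<^sup>2 / 4 < inverse \<gamma>1"
begin

abbreviation R where "R \<equiv> pd_R \<gamma>1 \<gamma>2 \<theta> B"
abbreviation S where "S \<equiv> pd_S \<gamma>1 \<gamma>2 \<theta> \<mu> B"
abbreviation M where "M \<equiv> R \<circ> inv S"

definition \<kappa> where "\<kappa> = inverse \<gamma>1 - \<gamma>2 * \<theta>\<^sup>2 * (onorm B)\<^sup>2 / 4"

text \<open>
  The condition on the parameters is symmetric under exchanging \<open>(\<gamma>1, B)\<close> with \<open>(\<gamma>2, B*)\<close>, up to the
  factor \<open>\<gamma>1 / \<gamma>2\<close>: the right-hand side is the analogue of \<open>\<kappa>\<close> with the roles of the spaces exchanged.
\<close>
lemma \<kappa>_dual: "\<gamma>1 / \<gamma>2 * \<kappa> = inverse \<gamma>2 - \<gamma>1 * (\<theta> / 2)\<^sup>2 * (onorm B)\<^sup>2"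
  using \<gamma>1 \<gamma>2 by (simp add: \<kappa>_def power_divide field_simps)

lemma \<kappa>_pos: "\<kappa> > 0"
  using gap by (simp add: \<kappa>_def)

lemmas linear_adjoint = adjoint_linear[OF linear_B]
lemmas adjoint_simps = adjoint_clauses[OF linear_B]

lemma norm_B_sq: "(norm (B x))\<^sup>2 \<le> (onorm B)\<^sup>2 * (norm x)\<^sup>2"
  using power_mono[OF onorm[of B x] norm_ge_zero, of 2] linear_B
  by (simp add: linear_conv_bounded_linear power_mult_distrib)

lemma norm_adjoint_sq: "(norm (adjoint B y))\<^sup>2 \<le> (onorm B)\<^sup>2 * (norm y)\<^sup>2"
proof -
  have "(norm (adjoint B y))\<^sup>2 = B (adjoint B y) \<bullet> y"
    by (simp add: power2_norm_eq_inner adjoint_simps inner_commute)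
  also have "\<dots> \<le> norm (B (adjoint B y)) * norm y" by (rule norm_cauchy_schwarz)
  also have "\<dots> \<le> onorm B * norm (adjoint B y) * norm y"
    using onorm[of B] linear_B by (intro mult_right_mono) (auto simp: linear_conv_bounded_linear)
  finally have "norm (adjoint B y) * norm (adjoint B y) \<le> norm (adjoint B y) * (onorm B * norm y)"
    by (simp add: power2_eq_square mult_ac)
  moreover have "0 \<le> onorm B" using linear_B by (simp add: onorm_pos_le linear_conv_bounded_linear)
  ultimately have "norm (adjoint B y) \<le> onorm B * norm y"
    by (cases "adjoint B y = 0") auto
  from power_mono[OF this norm_ge_zero, of 2] show ?thesis by (simp add: power_mult_distrib)
qed

lemma linear_R: "linear R"
  by (rule linearI)
    (auto simp: pd_R_def linear_add[OF linear_B] linear_add[OF linear_adjoint]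
      linear_scale[OF linear_B] linear_scale[OF linear_adjoint] algebra_simps)

lemma linear_S: "linear S"
  by (rule linearI)
    (auto simp: pd_S_def linear_add[OF linear_B] linear_add[OF linear_adjoint]
      linear_scale[OF linear_B] linear_scale[OF linear_adjoint] algebra_simps)

text \<open>
  The right-hand side is the numerator of the step size, without the factor \<open>\<lambda>\<close>.
\<close>
lemma inner_R:
  "(x, y) \<bullet> R (x, y) = inverse \<gamma>1 * (norm x)\<^sup>2 + inverse \<gamma>2 * (norm y)\<^sup>2 - \<theta> * (x \<bullet> adjoint B y)"
proof -
  have "y \<bullet> B x = x \<bullet> adjoint B y" by (simp add: adjoint_works[OF linear_B] inner_commute)
  then show ?thesis
    by (simp add: pd_R_def inner_diff_right inner_add_right power2_norm_eq_inner left_diff_distrib)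
qed

lemma R_coercive_fst: "\<kappa> * (norm x)\<^sup>2 \<le> (x, y) \<bullet> R (x, y)"
proof -
  have "\<gamma>2 * (\<theta> / 2)\<^sup>2 * (norm (B x))\<^sup>2 \<le> \<gamma>2 * (\<theta> / 2)\<^sup>2 * ((onorm B)\<^sup>2 * (norm x)\<^sup>2)"
    using \<gamma>2 norm_B_sq by (intro mult_left_mono) auto
  then show ?thesis
    using complete_square_lower_bound[OF \<gamma>2, of "- \<theta> / 2" "B x" y]
    by (simp add: inner_R \<kappa>_def adjoint_simps power_divide algebra_simps)
qed

lemma R_coercive_snd: "\<gamma>1 / \<gamma>2 * \<kappa> * (norm y)\<^sup>2 \<le> (x, y) \<bullet> R (x, y)"
proof -
  have "\<gamma>1 * (\<theta> / 2)\<^sup>2 * (norm (adjoint B y))\<^sup>2 \<le> \<gamma>1 * (\<theta> / 2)\<^sup>2 * ((onorm B)\<^sup>2 * (norm y)\<^sup>2)"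
    using \<gamma>1 norm_adjoint_sq by (intro mult_left_mono) auto
  then show ?thesis unfolding \<kappa>_dual
    using complete_square_lower_bound[OF \<gamma>1, of "- \<theta> / 2" "adjoint B y" x]
    by (simp add: inner_R inner_commute[of x] algebra_simps)
qed

lemma R_coercive: "\<exists>c>0. \<forall>z. c * (norm z)\<^sup>2 \<le> z \<bullet> R z"
proof (intro exI conjI allI)
  let ?c = "min \<kappa> (\<gamma>1 / \<gamma>2 * \<kappa>) / 2"
  show "?c > 0" using \<gamma>1 \<gamma>2 \<kappa>_pos by simp
  fix z :: "'a \<times> 'b"
  obtain x y where z: "z = (x, y)" by fastforce
  have "min \<kappa> (\<gamma>1 / \<gamma>2 * \<kappa>) * (norm x)\<^sup>2 \<le> \<kappa> * (norm x)\<^sup>2"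
    "min \<kappa> (\<gamma>1 / \<gamma>2 * \<kappa>) * (norm y)\<^sup>2 \<le> \<gamma>1 / \<gamma>2 * \<kappa> * (norm y)\<^sup>2"
    by (intro mult_right_mono; simp)+
  then have "min \<kappa> (\<gamma>1 / \<gamma>2 * \<kappa>) * ((norm x)\<^sup>2 + (norm y)\<^sup>2) \<le> 2 * ((x, y) \<bullet> R (x, y))"
    using R_coercive_fst[of x y] R_coercive_snd[of y x] unfolding distrib_left by linarith
  then show "?c * (norm z)\<^sup>2 \<le> z \<bullet> R z" by (simp add: z norm_Pair)
qed

text \<open>
  The two mixed terms get the coefficients \<open>(1 - \<mu>) (2 - \<theta>) - 1\<close> and \<open>(1 - \<theta>) - \<mu> (2 - \<theta>)\<close>. That these
  agree is the reason for the choice of \<open>S\<close>: it makes the form symmetric, and hence \<open>M\<close> self-adjoint.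
\<close>
lemma S_R_expand:
  "S (x, y) \<bullet> R (x', y') =
     inverse \<gamma>1 * (x \<bullet> x') + inverse \<gamma>2 * (y \<bullet> y')
     + \<mu> * \<gamma>1 * (2 - \<theta>) * (adjoint B y \<bullet> adjoint B y')
     + (1 - \<mu>) * \<gamma>2 * (1 - \<theta>) * (2 - \<theta>) * (B x \<bullet> B x')
     + ((1 - \<mu>) * (1 - \<theta>) - \<mu>) * (B x \<bullet> y' + B x' \<bullet> y)"
proof -
  have adj: "x \<bullet> adjoint B y' = B x \<bullet> y'" "adjoint B y \<bullet> x' = B x' \<bullet> y" "y \<bullet> B x' = B x' \<bullet> y"
    by (simp_all add: adjoint_simps inner_commute)
  \<comment> \<open>The cancelling products are kept visible so that the mixed coefficients can be compared.\<close>
  have cancel: "inverse \<gamma>1 * \<gamma>1 = 1" "inverse \<gamma>2 * \<gamma>2 = 1" using \<gamma>1 \<gamma>2 by simp_all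
  have "S (x, y) \<bullet> R (x', y') =
      inverse \<gamma>1 * (x \<bullet> x') + inverse \<gamma>2 * (y \<bullet> y')
      + \<mu> * \<gamma>1 * (2 - \<theta>) * (adjoint B y \<bullet> adjoint B y')
      + (1 - \<mu>) * \<gamma>2 * (1 - \<theta>) * (2 - \<theta>) * (B x \<bullet> B x')
      + ((inverse \<gamma>2 * \<gamma>2) * (1 - \<mu>) * (2 - \<theta>) - 1) * (B x \<bullet> y')
      + ((1 - \<theta>) - (inverse \<gamma>1 * \<gamma>1) * \<mu> * (2 - \<theta>)) * (B x' \<bullet> y)"
    by (simp add: pd_R_def pd_S_def inner_diff_left inner_diff_right inner_add_left inner_add_right
        adj algebra_simps del: left_inverse right_inverse)
  then show ?thesis unfolding cancel by (simp add: algebra_simps)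
qed

lemma S_R_symmetric: "S z \<bullet> R z' = S z' \<bullet> R z"
proof -
  obtain x y x' y' where z: "z = (x, y)" "z' = (x', y')" by fastforce
  show ?thesis unfolding z S_R_expand by (simp add: inner_commute add.commute)
qed

lemma S_R_eq_V: "S (x, y) \<bullet> R (x, y) = pd_V \<gamma>1 \<gamma>2 \<theta> \<mu> B x y"
  unfolding S_R_expand by (simp add: pd_V_def adjoint_works[OF linear_B, of x y] power2_norm_eq_inner)

text \<open>
  Positivity of \<open>V\<close> therefore has to be checked only at \<open>\<mu> = 0\<close> and \<open>\<mu> = 1\<close>, where it is a matter of
  completing a single square.
\<close>
lemma pd_V_affine_in_\<mu>:
  "pd_V \<gamma>1 \<gamma>2 \<theta> \<mu> B x y = (1 - \<mu>) * pd_V \<gamma>1 \<gamma>2 \<theta> 0 B x y + \<mu> * pd_V \<gamma>1 \<gamma>2 \<theta> 1 B x y"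
  by (simp add: pd_V_def algebra_simps)

lemma one_minus_\<theta>_bound: "- (\<theta> / 2)\<^sup>2 \<le> 1 - \<theta>"
  using zero_le_power2[of "\<theta> / 2 - 1"] by (simp add: power2_eq_square algebra_simps)

text \<open>
  Completing the square in \<open>y\<close> leaves \<open>\<parallel>x\<parallel>\<^sup>2 / \<gamma>1 + \<gamma>2 (1 - \<theta>) \<parallel>B x\<parallel>\<^sup>2\<close>, and \<open>1 - \<theta> \<ge> - \<theta>\<^sup>2 / 4\<close> turns
  this into \<open>\<kappa> \<parallel>x\<parallel>\<^sup>2\<close> at least.
\<close>
lemma pd_V_0_pos:
  assumes "(x, y) \<noteq> 0"
  shows "pd_V \<gamma>1 \<gamma>2 \<theta> 0 B x y > 0"
proof (cases "x = 0")
  case True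
  then show ?thesis using assms \<gamma>2 linear_0[OF linear_B] by (simp add: pd_V_def zero_prod_def)
next
  case False
  have "- (\<gamma>2 * (\<theta> / 2)\<^sup>2 * ((onorm B)\<^sup>2 * (norm x)\<^sup>2)) \<le> - (\<gamma>2 * (\<theta> / 2)\<^sup>2 * (norm (B x))\<^sup>2)"
    using \<gamma>2 norm_B_sq by (simp add: mult_left_mono)
  also have "\<dots> \<le> \<gamma>2 * (1 - \<theta>) * (norm (B x))\<^sup>2"
    using mult_right_mono[OF mult_left_mono[OF one_minus_\<theta>_bound, of \<gamma>2], of "(norm (B x))\<^sup>2"] \<gamma>2 by simp
  also have "\<dots> \<le> pd_V \<gamma>1 \<gamma>2 \<theta> 0 B x y - inverse \<gamma>1 * (norm x)\<^sup>2"
    using complete_square_lower_bound[OF \<gamma>2, of "1 - \<theta>" "B x" y]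
    by (simp add: pd_V_def adjoint_simps power2_eq_square algebra_simps)
  finally have "\<kappa> * (norm x)\<^sup>2 \<le> pd_V \<gamma>1 \<gamma>2 \<theta> 0 B x y"
    by (simp add: \<kappa>_def power_divide algebra_simps)
  moreover have "\<kappa> * (norm x)\<^sup>2 > 0" using False \<kappa>_pos by simp
  ultimately show ?thesis by linarith
qed

text \<open>The mirror image of the previous argument, with the square completed in \<open>x\<close>.\<close>
lemma pd_V_1_pos:
  assumes "(x, y) \<noteq> 0"
  shows "pd_V \<gamma>1 \<gamma>2 \<theta> 1 B x y > 0"
proof (cases "y = 0")
  case True
  then show ?thesis using assms \<gamma>1 linear_0[OF linear_adjoint] by (simp add: pd_V_def zero_prod_def)
next
  case False
  have "- (\<gamma>1 * (\<theta> / 2)\<^sup>2 * ((onorm B)\<^sup>2 * (norm y)\<^sup>2)) \<le> - (\<gamma>1 * (\<theta> / 2)\<^sup>2 * (norm (adjoint B y))\<^sup>2)"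
    using \<gamma>1 norm_adjoint_sq by (simp add: mult_left_mono)
  also have "\<dots> \<le> \<gamma>1 * (1 - \<theta>) * (norm (adjoint B y))\<^sup>2"
    using mult_right_mono[OF mult_left_mono[OF one_minus_\<theta>_bound, of \<gamma>1], of "(norm (adjoint B y))\<^sup>2"] \<gamma>1 by simp
  also have "\<dots> \<le> pd_V \<gamma>1 \<gamma>2 \<theta> 1 B x y - inverse \<gamma>2 * (norm y)\<^sup>2"
    using complete_square_lower_bound[OF \<gamma>1, of "- 1" "adjoint B y" x]
    by (simp add: pd_V_def inner_commute[of x] algebra_simps)
  finally have "\<gamma>1 / \<gamma>2 * \<kappa> * (norm y)\<^sup>2 \<le> pd_V \<gamma>1 \<gamma>2 \<theta> 1 B x y"
    unfolding \<kappa>_dual by (simp add: algebra_simps)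
  moreover have "\<gamma>1 / \<gamma>2 * \<kappa> * (norm y)\<^sup>2 > 0" using False \<kappa>_pos \<gamma>1 \<gamma>2 by simp
  ultimately show ?thesis by linarith
qed

lemma pd_V_pos:
  assumes "(x, y) \<noteq> 0"
  shows "pd_V \<gamma>1 \<gamma>2 \<theta> \<mu> B x y > 0"
proof -
  have "0 < (1 - \<mu>) * pd_V \<gamma>1 \<gamma>2 \<theta> 0 B x y + \<mu> * pd_V \<gamma>1 \<gamma>2 \<theta> 1 B x y"
  proof (cases "\<mu> = 0")
    case False
    with \<mu> pd_V_0_pos[OF assms] pd_V_1_pos[OF assms] show ?thesis
      by (intro add_nonneg_pos) auto
  qed (use pd_V_0_pos[OF assms] in simp)
  then show ?thesis by (simp only: pd_V_affine_in_\<mu>)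
qed

lemma S_R_pos: "z \<noteq> 0 \<Longrightarrow> S z \<bullet> R z > 0"
  by (cases z) (simp add: S_R_eq_V pd_V_pos)

lemma bij_S: "bij S"
proof -
  have "z = 0" if "S z = 0" for z using S_R_pos[of z] that by fastforce
  then have "inj S" by (simp add: linear_injective_0[OF linear_S])
  then show ?thesis using linear_injective_imp_surjective[OF linear_S] by (simp add: bij_def)
qed

lemma bij_R: "bij R"
proof -
  have "z = 0" if "R z = 0" for z using S_R_pos[of z] that by fastforce
  then have "inj R" by (simp add: linear_injective_0[OF linear_R])
  then show ?thesis using linear_injective_imp_surjective[OF linear_R] by (simp add: bij_def)
qed

lemma M_S: "M (S d) = R d"
  using bij_S by (simp add: bij_def)

lemma inv_M_R: "inv M (R d) = S d"
proof (rule inv_f_eq)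
  show "inj M" using bij_R bij_S by (meson bij_comp bij_imp_bij_inv bij_is_inj)
qed (rule M_S)

lemma linear_M: "linear M"
proof (rule linear_compose[OF _ linear_R])
  show "linear (inv S)"
    using bij_S linear_S by (simp add: bij_def inj_linear_imp_inv_linear)
qed

lemma M_symmetric: "z \<bullet> M z' = z' \<bullet> M z"
proof -
  obtain a b where "z = S a" "z' = S b" using bij_S by (metis bij_pointE)
  then show ?thesis by (simp only: M_S S_R_symmetric)
qed

lemma norm_wrt_M_sq: "(norm_wrt M z)\<^sup>2 = z \<bullet> M z"
proof -
  obtain a where a: "z = S a" using bij_S by (metis bij_pointE)
  have "0 \<le> z \<bullet> M z" unfolding a M_S
    using S_R_pos[of a] linear_0[OF linear_R] by (cases "a = 0") auto
  then show ?thesis by (simp add: norm_wrt_def)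
qed

text \<open>
  The source of a contraction factor that is uniform in the iteration: both forms are comparable to
  the Euclidean norm, from above for \<open>M\<close> and from below for \<open>R\<close>.
\<close>
lemma M_dominated_by_R: "\<exists>\<eta>>0. \<forall>d. \<eta> * (d \<bullet> M d) \<le> d \<bullet> R d"
proof -
  obtain c where c: "c > 0" "\<And>z. c * (norm z)\<^sup>2 \<le> z \<bullet> R z" using R_coercive by blast
  obtain C where C: "C > 0" "\<And>z. norm (M z) \<le> C * norm z"
    using linear_bounded_pos[OF linear_M] by blast
  have "c / C * (d \<bullet> M d) \<le> d \<bullet> R d" for d
  proof -
    have "d \<bullet> M d \<le> norm d * norm (M d)" by (rule norm_cauchy_schwarz)
    also have "\<dots> \<le> norm d * (C * norm d)" using C(2) by (intro mult_left_mono) auto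
    finally have "c / C * (d \<bullet> M d) \<le> c / C * (norm d * (C * norm d))"
      using c(1) C(1) by (intro mult_left_mono) auto
    also have "\<dots> = c * (norm d)\<^sup>2" using C(1) by (simp add: power2_eq_square)
    finally show ?thesis using c(2)[of d] by linarith
  qed
  then show ?thesis using c(1) C(1) by (intro exI[of _ "c / C"]) simp
qed

text \<open>
  The hypothesis says that \<open>a\<close> is the step size belonging to the relaxation parameter \<open>l\<close>. It trades
  the total contribution \<open>a \<langle>S d, R d\<rangle>\<close> of \<open>\<parallel>S d\<parallel>\<^sub>M\<^sup>2\<close> for \<open>l \<langle>d, R d\<rangle>\<close>, and the mixed term of the
  second square is \<open>\<langle>d, M (S d)\<rangle> = \<langle>d, R d\<rangle>\<close> as well.
\<close>
lemma relaxed_step_identity: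
  assumes "a * (S d \<bullet> R d) = l * (d \<bullet> R d)"
  shows "(a - 1) * (norm_wrt M (S d))\<^sup>2 + (norm_wrt M (S d - d))\<^sup>2
           = (norm_wrt M d)\<^sup>2 - (2 - l) * (d \<bullet> R d)"
proof -
  have "(norm_wrt M (S d - d))\<^sup>2 = S d \<bullet> R d - 2 * (d \<bullet> R d) + d \<bullet> M d"
    unfolding norm_wrt_M_sq linear_diff[OF linear_M] inner_diff_left inner_diff_right M_S
      M_symmetric[of "S d" d] by simp
  then show ?thesis using assms unfolding norm_wrt_M_sq M_S by (simp add: algebra_simps)
qed

end

section \<open>The iteration\<close>

text \<open>
  The vector differs from an element of the operator at \<open>(xb, yb)\<close> only in the point at which the gradient
  is taken, and \<open>almost\<close> measures the price of that. The coupling terms with \<open>B\<close> cancel.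
\<close>
lemma enlargement_pd_operator:
  fixes B :: "'a::euclidean_space \<Rightarrow> 'b::euclidean_space"
  assumes "linear B" and g: "closed_proper_convex g" and h: "closed_proper_convex (convex_conjugate h)"
    and almost: "\<And>a. (gradf a - gradf x) \<bullet> (a - xb) \<ge> - \<epsilon>"
    and p: "p \<in> subdifferential g xb" and q: "q \<in> subdifferential (convex_conjugate h) yb"
  shows "(p + gradf x + adjoint B yb, q - B xb) \<in> enlargement \<epsilon> (pd_operator g h gradf B) (xb, yb)"
proof -
  have "- \<epsilon> \<le> ((p' + gradf a + adjoint B b, q' - B a) - (p + gradf x + adjoint B yb, q - B xb)) \<bullet> ((a, b) - (xb, yb))"
    if "p' \<in> subdifferential g a" "q' \<in> subdifferential (convex_conjugate h) b" for a b p' q'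
  proof -
    have "(p' - p) \<bullet> (a - xb) \<ge> 0" "(q' - q) \<bullet> (b - yb) \<ge> 0"
      using subdifferential_monotone[OF g p that(1)] subdifferential_monotone[OF h q that(2)] by auto
    moreover have "adjoint B (b - yb) \<bullet> (a - xb) - B (a - xb) \<bullet> (b - yb) = 0"
      by (simp add: adjoint_clauses[OF assms(1)] inner_commute)
    moreover have "((p' + gradf a + adjoint B b, q' - B a) - (p + gradf x + adjoint B yb, q - B xb)) \<bullet> ((a, b) - (xb, yb))
      = (p' - p) \<bullet> (a - xb) + (q' - q) \<bullet> (b - yb) + (gradf a - gradf x) \<bullet> (a - xb)
        + (adjoint B (b - yb) \<bullet> (a - xb) - B (a - xb) \<bullet> (b - yb))"
      unfolding linear_diff[OF assms(1)] linear_diff[OF adjoint_linear[OF assms(1)]]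
      by (simp add: inner_diff_left inner_diff_right inner_add_left)
    ultimately show ?thesis using almost[of a] by linarith
  qed
  then show ?thesis unfolding enlargement_def pd_operator_def by auto
qed

theorem proposition6:
  fixes B :: "'a::euclidean_space \<Rightarrow> 'b::euclidean_space"
    and g :: "'a \<Rightarrow> ereal" and h :: "'b \<Rightarrow> ereal"
    and f :: "'a \<Rightarrow> real" and gradf :: "'a \<Rightarrow> 'a"
    and L \<gamma>1 \<gamma>2 \<theta> \<mu> \<delta> lam_lo lam_hi :: real
    and lam \<alpha> \<epsilon> \<theta>seq :: "nat \<Rightarrow> real"
    and x xbar :: "nat \<Rightarrow> 'a" and y ybar :: "nat \<Rightarrow> 'b"
    and T :: "'a \<times> 'b \<Rightarrow> ('a \<times> 'b) set"
    and R S M :: "'a \<times> 'b \<Rightarrow> 'a \<times> 'b"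
    and w z v :: "nat \<Rightarrow> 'a \<times> 'b"
  assumes "linear B"
    and "closed_proper_convex g" and "closed_proper_convex h"
    and "convex_on UNIV f"
    and "\<And>u. GDERIV f u :> gradf u"
    and "\<And>u u'. norm (gradf u - gradf u') \<le> L * norm (u - u')"
    and T: "T = pd_operator g h gradf B"
    and "\<gamma>1 > 0" and "\<gamma>2 > 0" and "0 \<le> \<mu>" and "\<mu> \<le> 1" and "\<theta> \<ge> 0"
    and "inverse \<gamma>1 - \<gamma>2 * \<theta>\<^sup>2 * (onorm B)\<^sup>2 / 4 > L / 4"
    and \<delta>: "\<delta> = 2 - L / 2 * inverse (inverse \<gamma>1 - \<gamma>2 * \<theta>\<^sup>2 * (onorm B)\<^sup>2 / 4)"
    and "{lam_lo..lam_hi} \<subseteq> {0<..<\<delta>}" and "\<And>k. lam k \<in> {lam_lo..lam_hi}"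
    and "\<And>k. xbar k = prox \<gamma>1 g (x k - \<gamma>1 *\<^sub>R adjoint B (y k) - \<gamma>1 *\<^sub>R gradf (x k))"
    and "\<And>k. ybar k = prox \<gamma>2 (convex_conjugate h)
                 (y k + \<gamma>2 *\<^sub>R B ((1 - \<theta>) *\<^sub>R x k + \<theta> *\<^sub>R xbar k))"
    and "\<And>k. x (Suc k) = x k + \<alpha> k *\<^sub>R ((xbar k - x k)
                 - (\<mu> * \<gamma>1 * (2 - \<theta>)) *\<^sub>R adjoint B (ybar k - y k))"
    and "\<And>k. y (Suc k) = y k + \<alpha> k *\<^sub>R ((\<gamma>2 * (1 - \<mu>) * (2 - \<theta>)) *\<^sub>R B (xbar k - x k)
                 + (ybar k - y k))"
    and "\<And>k. (xbar k, ybar k) \<noteq> (x k, y k) \<Longrightarrow>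
           \<alpha> k = lam k * (inverse \<gamma>1 * (norm (xbar k - x k))\<^sup>2
                         + inverse \<gamma>2 * (norm (ybar k - y k))\<^sup>2
                         - \<theta> * ((xbar k - x k) \<bullet> adjoint B (ybar k - y k)))
                 / pd_V \<gamma>1 \<gamma>2 \<theta> \<mu> B (xbar k - x k) (ybar k - y k)"
    and R: "R = pd_R \<gamma>1 \<gamma>2 \<theta> B"
    and S: "S = pd_S \<gamma>1 \<gamma>2 \<theta> \<mu> B"
    and M: "M = R \<circ> inv S"
    and w: "\<And>k. w k = (xbar k, ybar k)"
    and z: "\<And>k. z k = (x k, y k)"
    and v: "\<And>k. v k = R (z k - w k)"
    and \<epsilon>: "\<And>k. \<epsilon> k = L * (norm (x k - xbar k))\<^sup>2 / 4"
    and \<theta>seq: "\<And>k. \<theta>seq k = \<alpha> k - 1"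
  shows "\<exists>\<sigma>::real. 0 \<le> \<sigma> \<and> \<sigma> < 1 \<and>
           (\<forall>k. v k \<in> enlargement (\<epsilon> k) T (w k) \<and>
                \<theta>seq k * (norm_wrt M (inv M (v k)))\<^sup>2
                  + (norm_wrt M (inv M (v k) + w k - z k))\<^sup>2 + 2 * \<epsilon> k
                  \<le> \<sigma> * (norm_wrt M (w k - z k))\<^sup>2 \<and>
                z (Suc k) = z k - (1 + \<theta>seq k) *\<^sub>R inv M (v k))"
proof -
  \<comment> \<open>A Lipschitz constant on a space with a nonzero vector is nonnegative.\<close>
  obtain u :: 'a where "u \<in> Basis" using nonempty_Basis by blast
  then have "0 \<le> L"
    using order_trans[OF norm_ge_zero assms(6)[of u 0]] by simp
  then interpret P: pd_parameters B \<gamma>1 \<gamma>2 \<theta> \<mu>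
    using assms(1,8-11,13) by (auto intro!: pd_parameters.intro)
  have R': "R = pd_R \<gamma>1 \<gamma>2 \<theta> B" and M': "M = pd_R \<gamma>1 \<gamma>2 \<theta> B \<circ> inv (pd_S \<gamma>1 \<gamma>2 \<theta> \<mu> B)"
    using R S M by simp_all
  have hconj: "closed_proper_convex (convex_conjugate h)"
    using assms(3) by (rule closed_proper_convex_conjugate)
  have lam: "lam k \<le> lam_hi" for k using assms(16)[of k] by simp
  have "lam_hi \<in> {lam_lo..lam_hi}" using assms(16)[of 0] by simp
  then have hi: "lam_hi < \<delta>" using assms(15) by auto
  have \<delta>': "\<delta> = 2 - L / 2 * inverse P.\<kappa>" unfolding P.\<kappa>_def by (rule \<delta>)
  obtain \<eta> where \<eta>: "\<eta> > 0" "\<And>d. \<eta> * (d \<bullet> P.M d) \<le> d \<bullet> P.R d"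
    using P.M_dominated_by_R by blast
  \<comment> \<open>\<open>(\<delta> - lam_hi) \<eta>\<close> may exceed \<open>1\<close>, hence the maximum with \<open>0\<close>.\<close>
  define \<sigma> where "\<sigma> = max 0 (1 - (\<delta> - lam_hi) * \<eta>)"
  have \<sigma>: "0 \<le> \<sigma>" "\<sigma> < 1" using hi \<eta>(1) by (auto simp: \<sigma>_def)
  have "v k \<in> enlargement (\<epsilon> k) T (w k)
      \<and> \<theta>seq k * (norm_wrt M (inv M (v k)))\<^sup>2 + (norm_wrt M (inv M (v k) + w k - z k))\<^sup>2 + 2 * \<epsilon> k
          \<le> \<sigma> * (norm_wrt M (w k - z k))\<^sup>2
      \<and> z (Suc k) = z k - (1 + \<theta>seq k) *\<^sub>R inv M (v k)" for k
  proof (intro conjI)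
    define d where "d = z k - w k"
    have d: "d = (x k - xbar k, y k - ybar k)" by (simp add: d_def z w)
    have invM: "inv M (v k) = P.S d" unfolding v d_def[symmetric] R' M' by (rule P.inv_M_R)
    have neg: "(xbar k - x k, ybar k - y k) = - d" by (simp add: d)
    show "v k \<in> enlargement (\<epsilon> k) T (w k)"
    proof -
      define a where "a = x k - \<gamma>1 *\<^sub>R adjoint B (y k) - \<gamma>1 *\<^sub>R gradf (x k)"
      define b where "b = y k + \<gamma>2 *\<^sub>R B ((1 - \<theta>) *\<^sub>R x k + \<theta> *\<^sub>R xbar k)"
      have "inverse \<gamma>1 *\<^sub>R (a - xbar k) \<in> subdifferential g (xbar k)"
        using prox_subgradient[OF assms(2,8)] assms(17)[of k] by (simp add: a_def)
      moreover have "inverse \<gamma>2 *\<^sub>R (b - ybar k) \<in> subdifferential (convex_conjugate h) (ybar k)"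
        using prox_subgradient[OF hconj assms(9)] assms(18)[of k] by (simp add: b_def)
      moreover have "- \<epsilon> k \<le> (gradf c - gradf (x k)) \<bullet> (c - xbar k)" for c
        unfolding \<epsilon> by (rule gradient_almost_monotone[OF assms(4,5,6)])
      ultimately have "(inverse \<gamma>1 *\<^sub>R (a - xbar k) + gradf (x k) + adjoint B (ybar k),
          inverse \<gamma>2 *\<^sub>R (b - ybar k) - B (xbar k)) \<in> enlargement (\<epsilon> k) T (w k)"
        unfolding T w using enlargement_pd_operator[OF assms(1,2) hconj] by blast
      moreover have "inverse \<gamma>1 *\<^sub>R (a - xbar k) + gradf (x k) + adjoint B (ybar k)
          = inverse \<gamma>1 *\<^sub>R (x k - xbar k) - adjoint B (y k - ybar k)"
        using assms(8) by (simp add: a_def linear_diff[OF P.linear_adjoint] scaleR_diff_right)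
      moreover have "inverse \<gamma>2 *\<^sub>R (b - ybar k) - B (xbar k)
          = (1 - \<theta>) *\<^sub>R B (x k - xbar k) + inverse \<gamma>2 *\<^sub>R (y k - ybar k)"
        using assms(9) by (simp add: b_def linear_diff[OF assms(1)] linear_add[OF assms(1)]
            linear_scale[OF assms(1)] scaleR_diff_right scaleR_diff_left scaleR_add_right
            flip: mult.assoc)
      ultimately show ?thesis by (simp add: v R' pd_R_def z w)
    qed
    \<comment> \<open>For \<open>d = 0\<close> the step size is arbitrary, but then both sides vanish.\<close>
    have step: "\<alpha> k * (P.S d \<bullet> P.R d) = lam k * (d \<bullet> P.R d)"
    proof (cases "d = 0")
      case True
      then show ?thesis by (simp add: linear_0[OF P.linear_R])
    next
      case False
      have V: "pd_V \<gamma>1 \<gamma>2 \<theta> \<mu> B (xbar k - x k) (ybar k - y k) = P.S d \<bullet> P.R d"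
        by (simp add: neg linear_neg[OF P.linear_R] linear_neg[OF P.linear_S] flip: P.S_R_eq_V)
      have q: "inverse \<gamma>1 * (norm (xbar k - x k))\<^sup>2 + inverse \<gamma>2 * (norm (ybar k - y k))\<^sup>2
          - \<theta> * ((xbar k - x k) \<bullet> adjoint B (ybar k - y k)) = d \<bullet> P.R d"
        by (simp add: neg linear_neg[OF P.linear_R] flip: P.inner_R)
      have "(xbar k, ybar k) \<noteq> (x k, y k)" using False by (auto simp: d zero_prod_def)
      from assms(21)[OF this] show ?thesis
        unfolding V q using P.S_R_pos[OF False] by simp
    qed
    have arg: "inv M (v k) + w k - z k = P.S d - d" unfolding invM by (simp add: d_def)
    have quad: "\<theta>seq k * (norm_wrt M (inv M (v k)))\<^sup>2 + (norm_wrt M (inv M (v k) + w k - z k))\<^sup>2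
        = (norm_wrt P.M d)\<^sup>2 - (2 - lam k) * (d \<bullet> P.R d)"
      unfolding arg unfolding invM \<theta>seq unfolding M' by (rule P.relaxed_step_identity[OF step])
    have "(\<delta> - lam_hi) * (d \<bullet> P.R d) + 2 * \<epsilon> k \<le> (2 - lam k) * (d \<bullet> P.R d)"
    proof -
      have "L / 2 * inverse P.\<kappa> * (P.\<kappa> * (norm (x k - xbar k))\<^sup>2) \<le> L / 2 * inverse P.\<kappa> * (d \<bullet> P.R d)"
        unfolding d using \<open>0 \<le> L\<close> P.\<kappa>_pos by (intro mult_left_mono P.R_coercive_fst) simp
      moreover have "L / 2 * inverse P.\<kappa> * (P.\<kappa> * (norm (x k - xbar k))\<^sup>2) = 2 * \<epsilon> k"
        using P.\<kappa>_pos by (simp add: \<epsilon> field_simps)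
      moreover have "0 \<le> d \<bullet> P.R d"
        unfolding d using P.\<kappa>_pos by (intro order_trans[OF _ P.R_coercive_fst]) simp
      then have "(\<delta> - lam_hi + L / 2 * inverse P.\<kappa>) * (d \<bullet> P.R d) \<le> (2 - lam k) * (d \<bullet> P.R d)"
        using lam[of k] by (intro mult_right_mono) (simp_all add: \<delta>')
      ultimately show ?thesis unfolding distrib_right by linarith
    qed
    moreover have "(1 - \<sigma>) * (norm_wrt P.M d)\<^sup>2 \<le> (\<delta> - lam_hi) * \<eta> * (d \<bullet> P.M d)"
      unfolding P.norm_wrt_M_sq[symmetric] by (intro mult_right_mono) (auto simp: \<sigma>_def)
    moreover have "(\<delta> - lam_hi) * (\<eta> * (d \<bullet> P.M d)) \<le> (\<delta> - lam_hi) * (d \<bullet> P.R d)"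
      using hi \<eta>(2) by (intro mult_left_mono) auto
    ultimately have "(norm_wrt P.M d)\<^sup>2 - (2 - lam k) * (d \<bullet> P.R d) + 2 * \<epsilon> k \<le> \<sigma> * (norm_wrt P.M d)\<^sup>2"
      unfolding left_diff_distrib mult.assoc by linarith
    moreover have "w k - z k = - d" by (simp add: d_def)
    then have "(norm_wrt M (w k - z k))\<^sup>2 = (norm_wrt P.M d)\<^sup>2"
      unfolding M' P.norm_wrt_M_sq by (simp only: linear_neg[OF P.linear_M] inner_minus_left inner_minus_right minus_minus)
    ultimately show "\<theta>seq k * (norm_wrt M (inv M (v k)))\<^sup>2 + (norm_wrt M (inv M (v k) + w k - z k))\<^sup>2 + 2 * \<epsilon> k
        \<le> \<sigma> * (norm_wrt M (w k - z k))\<^sup>2"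
      unfolding quad by simp
    have "z (Suc k) = z k + \<alpha> k *\<^sub>R P.S (xbar k - x k, ybar k - y k)"
      unfolding z by (simp add: assms(19,20) pd_S_def)
    then show "z (Suc k) = z k - (1 + \<theta>seq k) *\<^sub>R inv M (v k)"
      unfolding neg invM \<theta>seq by (simp add: linear_neg[OF P.linear_S])
  qed
  with \<sigma> show ?thesis by blast
qed

end
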